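(* Every cofinite directed graph $\Gamma$ has a completion, and it is unique up to an isomorphism of topological directed graphs extending the identity map on $\Gamma$. (That is, if $\overline\Gamma_1$ and $\overline\Gamma_2$ are completions of $\Gamma$, there is an isomorphism of topological directed graphs $\overline\Gamma_1\to\overline\Gamma_2$ that restricts to the identity map on $\Gamma$.)
   Context: A directed graph is a set $\Gamma$ with a distinguished subset $V(\Gamma)$ and two functions $s,t\colon\Gamma\to V(\Gamma)$ satisfying $s(x)=t(x)=x$ for all $x\in V(\Gamma)$. A sub-directed graph is a subset closed under $s$ and $t$. A map of directed graphs is a function preserving sources and targets. A topological directed graph is a directed graph with a topology such that $s,t\colon\Gamma\to V(\Gamma)$ are continuous ($V(\Gamma)$ with the subspace topology). An isomorphism of topological directed graphs is an isomorphism of directed graphs that is a homeomorphism. An equivalence relation $R$ on $\Gamma$ is compatible if $(x,y)\in R$ implies $(s(x),s(y))\in R$ and $(t(x),t(y))\in R$; it has finite index if $\Gamma/R$ is finite. For a directed graph with a uniformity, a cofinite entourage is a compatible equivalence relation of finite index which is also an entourage. A cofinite directed graph is a directed graph endowed with a Hausdorff uniformity that has a base consisting of cofinite entourages. Every compact Hausdorff space is regarded as a uniform space with the unique uniformity inducing its topology. A completion of a cofinite directed graph $\Gamma$ is a compact Hausdorff topological directed graph $\overline\Gamma$ that contains $\Gamma$ as a dense uniform sub-directed graph (i.e. $\Gamma$ is a dense sub-directed graph and the uniformity of $\Gamma$ is the one induced from $\overline\Gamma$). *)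

theory Defs
  imports "HOL-Analysis.Analysis"
begin

section \<open>Uniformities on a set\<close>

definition is_uniformity :: "'a set \<Rightarrow> ('a \<times> 'a) set set \<Rightarrow> bool" where
  "is_uniformity X \<U> \<longleftrightarrow>
     X \<times> X \<in> \<U> \<and>
     (\<forall>E\<in>\<U>. Id_on X \<subseteq> E \<and> E \<subseteq> X \<times> X) \<and>
     (\<forall>E\<in>\<U>. \<forall>F. E \<subseteq> F \<and> F \<subseteq> X \<times> X \<longrightarrow> F \<in> \<U>) \<and>
     (\<forall>E\<in>\<U>. \<forall>F\<in>\<U>. E \<inter> F \<in> \<U>) \<and>
     (\<forall>E\<in>\<U>. E\<inverse> \<in> \<U>) \<and>
     (\<forall>E\<in>\<U>. \<exists>F\<in>\<U>. F O F \<subseteq> E)"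

definition uniform_topology :: "'a set \<Rightarrow> ('a \<times> 'a) set set \<Rightarrow> 'a topology" where
  "uniform_topology X \<U> = topology (\<lambda>S. S \<subseteq> X \<and> (\<forall>x\<in>S. \<exists>E\<in>\<U>. E `` {x} \<subseteq> S))"

definition is_hausdorff_uniformity :: "'a set \<Rightarrow> ('a \<times> 'a) set set \<Rightarrow> bool" where
  "is_hausdorff_uniformity X \<U> \<longleftrightarrow>
     is_uniformity X \<U> \<and> Hausdorff_space (uniform_topology X \<U>)"

text \<open>The unique uniformity inducing the topology of a compact Hausdorff space; it is
  well defined by \<open>ex1_compact_uniformity\<close> below, and meaningless for other spaces.\<close>

definition compact_uniformity :: "'a topology \<Rightarrow> ('a \<times> 'a) set set" where
  "compact_uniformity T =
     (THE \<U>. is_uniformity (topspace T) \<U> \<and> uniform_topology (topspace T) \<U> = T)"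

text \<open>The uniformity induced on \<open>X\<close> along a map \<open>i\<close>. The images of entourages themselves (and not
  just their supersets) are taken, which gives a uniformity only because it is used for
  injective \<open>i\<close>; for an inclusion it is the trace \<open>{F \<inter> X \<times> X |F. F \<in> \<V>}\<close>.\<close>

definition induced_uniformity :: "('a \<Rightarrow> 'b) \<Rightarrow> 'a set \<Rightarrow> ('b \<times> 'b) set set \<Rightarrow> ('a \<times> 'a) set set" where
  "induced_uniformity i X \<V> = (\<lambda>F. {(x, y). x \<in> X \<and> y \<in> X \<and> (i x, i y) \<in> F}) ` \<V>"


subsection \<open>Well-definedness\<close>

lemma is_uniformityD:
  assumes "is_uniformity X \<U>"
  shows "X \<times> X \<in> \<U>"
    and "\<And>E x. E \<in> \<U> \<Longrightarrow> x \<in> X \<Longrightarrow> (x, x) \<in> E"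
    and "\<And>E. E \<in> \<U> \<Longrightarrow> E \<subseteq> X \<times> X"
    and "\<And>E F. E \<in> \<U> \<Longrightarrow> E \<subseteq> F \<Longrightarrow> F \<subseteq> X \<times> X \<Longrightarrow> F \<in> \<U>"
    and "\<And>E F. E \<in> \<U> \<Longrightarrow> F \<in> \<U> \<Longrightarrow> E \<inter> F \<in> \<U>"
    and "\<And>E. E \<in> \<U> \<Longrightarrow> E\<inverse> \<in> \<U>"
    and "\<And>E. E \<in> \<U> \<Longrightarrow> \<exists>F\<in>\<U>. F O F \<subseteq> E"
proof -
  note U = assms[unfolded is_uniformity_def]
  show "X \<times> X \<in> \<U>"
    using U by (elim conjE)
  show "(x, x) \<in> E" if "E \<in> \<U>" "x \<in> X" for E x
    using U[THEN conjunct2, THEN conjunct1] that by blast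
  show "E \<subseteq> X \<times> X" if "E \<in> \<U>" for E
    using U[THEN conjunct2, THEN conjunct1] that by blast
  show "F \<in> \<U>" if "E \<in> \<U>" "E \<subseteq> F" "F \<subseteq> X \<times> X" for E F
    using U[THEN conjunct2, THEN conjunct2, THEN conjunct1] that by simp
  show "E \<inter> F \<in> \<U>" if "E \<in> \<U>" "F \<in> \<U>" for E F
    using U[THEN conjunct2, THEN conjunct2, THEN conjunct2, THEN conjunct1] that by simp
  show "E\<inverse> \<in> \<U>" if "E \<in> \<U>" for E
    using U[THEN conjunct2, THEN conjunct2, THEN conjunct2, THEN conjunct2, THEN conjunct1] that by simp
  show "\<exists>F\<in>\<U>. F O F \<subseteq> E" if "E \<in> \<U>" for E
    using U[THEN conjunct2, THEN conjunct2, THEN conjunct2, THEN conjunct2, THEN conjunct2] that by simp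
qed

lemma openin_uniform_topology:
  assumes "is_uniformity X \<U>"
  shows "openin (uniform_topology X \<U>) S \<longleftrightarrow> S \<subseteq> X \<and> (\<forall>x\<in>S. \<exists>E\<in>\<U>. E `` {x} \<subseteq> S)"
proof -
  have inter: "E \<inter> F \<in> \<U>" if "E \<in> \<U>" "F \<in> \<U>" for E F
    by (rule is_uniformityD(5)[OF assms that])
  have "istopology (\<lambda>S. S \<subseteq> X \<and> (\<forall>x\<in>S. \<exists>E\<in>\<U>. E `` {x} \<subseteq> S))"
    unfolding istopology_def
  proof (intro conjI allI impI ballI)
    fix S T x
    assume S: "S \<subseteq> X \<and> (\<forall>x\<in>S. \<exists>E\<in>\<U>. E `` {x} \<subseteq> S)"
      and T: "T \<subseteq> X \<and> (\<forall>x\<in>T. \<exists>E\<in>\<U>. E `` {x} \<subseteq> T)" and x: "x \<in> S \<inter> T"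
    obtain E F where "E \<in> \<U>" "F \<in> \<U>" "E `` {x} \<subseteq> S" "F `` {x} \<subseteq> T"
      using S T x by blast
    then show "\<exists>E\<in>\<U>. E `` {x} \<subseteq> S \<inter> T"
      using inter by (intro bexI[of _ "E \<inter> F"]) auto
  next
    fix \<K> x
    assume "\<forall>K\<in>\<K>. K \<subseteq> X \<and> (\<forall>x\<in>K. \<exists>E\<in>\<U>. E `` {x} \<subseteq> K)" "x \<in> \<Union>\<K>"
    then show "\<exists>E\<in>\<U>. E `` {x} \<subseteq> \<Union>\<K>"
      by (meson Sup_upper UnionE subset_trans)
  qed auto
  then show ?thesis
    by (simp add: uniform_topology_def topology_inverse')
qed

lemma topspace_uniform_topology:
  assumes "is_uniformity X \<U>"
  shows "topspace (uniform_topology X \<U>) = X"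
proof (rule antisym)
  show "topspace (uniform_topology X \<U>) \<subseteq> X"
    using openin_uniform_topology[OF assms] openin_topspace by blast
  have "X \<times> X \<in> \<U>"
    by (rule is_uniformityD(1)[OF assms])
  then have "openin (uniform_topology X \<U>) X"
    unfolding openin_uniform_topology[OF assms]
    by (intro conjI ballI bexI[of _ "X \<times> X"]) auto
  then show "X \<subseteq> topspace (uniform_topology X \<U>)"
    by (rule openin_subset)
qed

lemma uniform_neighbourhood:
  assumes U: "is_uniformity X \<U>" and E: "E \<in> \<U>" and x: "x \<in> X"
  shows "\<exists>N. openin (uniform_topology X \<U>) N \<and> x \<in> N \<and> N \<subseteq> E `` {x}"
proof -
  define N where "N = {y \<in> X. \<exists>F\<in>\<U>. F `` {y} \<subseteq> E `` {x}}"
  have refl: "(y, y) \<in> F" if "F \<in> \<U>" "y \<in> X" for F y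
    by (rule is_uniformityD(2)[OF U that])
  have "\<exists>G\<in>\<U>. G `` {y} \<subseteq> N" if y: "y \<in> N" for y
  proof -
    obtain F where F: "F \<in> \<U>" "F `` {y} \<subseteq> E `` {x}"
      using y unfolding N_def by blast
    obtain G where G: "G \<in> \<U>" "G O G \<subseteq> F"
      using is_uniformityD(7)[OF U F(1)] by blast
    have GX: "G \<subseteq> X \<times> X"
      by (rule is_uniformityD(3)[OF U G(1)])
    have "z \<in> N" if "(y, z) \<in> G" for z
    proof -
      have "G `` {z} \<subseteq> F `` {y}"
        using that G(2) by blast
      then show ?thesis
        unfolding N_def using F(2) G(1) GX that by blast
    qed
    then show ?thesis
      using G(1) by blast
  qed
  then have "openin (uniform_topology X \<U>) N"
    unfolding openin_uniform_topology[OF U] N_def by blast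
  moreover have "x \<in> N"
    unfolding N_def using E x by blast
  moreover have "N \<subseteq> E `` {x}"
    unfolding N_def using refl by blast
  ultimately show ?thesis
    by blast
qed

definition diagonal_nhds :: "'a topology \<Rightarrow> ('a \<times> 'a) set set" where
  "diagonal_nhds T =
     {E. E \<subseteq> topspace T \<times> topspace T \<and>
         (\<exists>W. openin (prod_topology T T) W \<and> Id_on (topspace T) \<subseteq> W \<and> W \<subseteq> E)}"

lemma is_uniformity_diagonal_nhds:
  assumes "compact_space T" "Hausdorff_space T"
  shows "is_uniformity (topspace T) (diagonal_nhds T)"
proof -
  let ?X = "topspace T"
  have comp: "\<exists>F\<in>diagonal_nhds T. F O F \<subseteq> E" if E: "E \<in> diagonal_nhds T" for E
  proof -
    obtain W where W: "openin (prod_topology T T) W" "Id_on ?X \<subseteq> W" "W \<subseteq> E"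
      using E unfolding diagonal_nhds_def by blast
    have "\<exists>A B C. openin T A \<and> openin T B \<and> closedin T C \<and> x \<in> B \<and> B \<subseteq> C \<and> C \<subseteq> A \<and> A \<times> A \<subseteq> W"
      if x: "x \<in> ?X" for x
    proof -
      have "(x, x) \<in> W"
        using W(2) x by blast
      then obtain P Q where PQ: "openin T P" "openin T Q" "x \<in> P" "x \<in> Q" "P \<times> Q \<subseteq> W"
        using W(1) unfolding openin_prod_topology_alt by meson
      have "openin T (P \<inter> Q)" "x \<in> P \<inter> Q"
        using PQ by auto
      moreover have "neighbourhood_base_of (closedin T) T"
        using compact_Hausdorff_imp_regular_space[OF assms] neighbourhood_base_of_closedin by blast
      ultimately obtain B C where BC: "openin T B" "closedin T C" "x \<in> B" "B \<subseteq> C" "C \<subseteq> P \<inter> Q"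
        unfolding neighbourhood_base_of by meson
      have "(P \<inter> Q) \<times> (P \<inter> Q) \<subseteq> W"
        using PQ(5) by blast
      with BC \<open>openin T (P \<inter> Q)\<close> show ?thesis
        by (intro exI[of _ "P \<inter> Q"] exI[of _ B] exI[of _ C] conjI)
    qed
    then obtain A B C where ABC: "\<And>x. x \<in> ?X \<Longrightarrow>
        openin T (A x) \<and> openin T (B x) \<and> closedin T (C x) \<and> x \<in> B x \<and> B x \<subseteq> C x \<and> C x \<subseteq> A x
        \<and> A x \<times> A x \<subseteq> W"
      by metis
    have "compactin T ?X"
      using assms(1) by (simp add: compact_space_def)
    moreover have "\<forall>V \<in> B ` ?X. openin T V" "?X \<subseteq> \<Union>(B ` ?X)"
      using ABC by blast+
    ultimately obtain \<F> where "finite \<F>" "\<F> \<subseteq> B ` ?X" "?X \<subseteq> \<Union>\<F>"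
      unfolding compactin_def by meson
    then obtain J where J: "finite J" "J \<subseteq> ?X" "?X \<subseteq> \<Union>(B ` J)"
      by (metis finite_subset_image)
    define D where "D j = (A j \<times> A j) \<union> ((?X - C j) \<times> (?X - C j))" for j
    define F where "F = (?X \<times> ?X) \<inter> \<Inter>(D ` J)"
    have Dop: "openin (prod_topology T T) (D j)" and Did: "Id_on ?X \<subseteq> D j" if "j \<in> J" for j
    proof -
      have j: "j \<in> ?X"
        using that J by blast
      then have "openin T (?X - C j)"
        using ABC by blast
      then show "openin (prod_topology T T) (D j)"
        unfolding D_def using ABC[OF j] by (simp add: openin_Un openin_prod_Times_iff)
      show "Id_on ?X \<subseteq> D j"
        unfolding D_def using ABC[OF j] by blast
    qed
    have "openin (prod_topology T T) F"
    proof (cases "J = {}")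
      case True
      then show ?thesis
        unfolding F_def by (simp add: openin_prod_Times_iff)
    next
      case False
      have "openin (prod_topology T T) (\<Inter>(D ` J))"
        by (rule openin_Inter) (use J(1) False Dop in auto)
      then show ?thesis
        unfolding F_def by (intro openin_Int) (auto simp: openin_prod_Times_iff)
    qed
    moreover have "Id_on ?X \<subseteq> F"
      unfolding F_def using Did by blast
    ultimately have "F \<in> diagonal_nhds T"
      unfolding diagonal_nhds_def F_def by blast
    moreover have "(p, r) \<in> E" if pq: "(p, q) \<in> F" and qr: "(q, r) \<in> F" for p q r
    proof -
      have "q \<in> ?X"
        using pq unfolding F_def by blast
      then obtain j where j: "j \<in> J" "q \<in> B j"
        using J(3) by blast
      have "(p, q) \<in> D j" "(q, r) \<in> D j"
        using pq qr j(1) unfolding F_def by blast+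
      moreover have "j \<in> ?X"
        using j J by blast
      moreover have "q \<in> C j"
        using ABC[OF \<open>j \<in> ?X\<close>] j(2) by blast
      ultimately have "(p, r) \<in> A j \<times> A j"
        unfolding D_def by blast
      then show ?thesis
        using ABC[OF \<open>j \<in> ?X\<close>] W(3) by blast
    qed
    ultimately show ?thesis
      by blast
  qed
  have inv: "E\<inverse> \<in> diagonal_nhds T" if E: "E \<in> diagonal_nhds T" for E
  proof -
    obtain W where W: "openin (prod_topology T T) W" "Id_on ?X \<subseteq> W" "W \<subseteq> E"
      using E unfolding diagonal_nhds_def by blast
    have "openin (prod_topology T T) (W\<inverse>)"
      unfolding openin_prod_topology_alt
    proof (intro allI impI)
      fix x y
      assume "(x, y) \<in> W\<inverse>"
      then obtain P Q where "openin T P" "openin T Q" "y \<in> P" "x \<in> Q" and PQ: "P \<times> Q \<subseteq> W"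
        using W(1) unfolding openin_prod_topology_alt by (meson converseD)
      moreover have "Q \<times> P \<subseteq> W\<inverse>"
        using PQ by blast
      ultimately show "\<exists>P Q. openin T P \<and> openin T Q \<and> x \<in> P \<and> y \<in> Q \<and> P \<times> Q \<subseteq> W\<inverse>"
        by meson
    qed
    moreover have "Id_on ?X \<subseteq> W\<inverse>" "W\<inverse> \<subseteq> E\<inverse>"
      using W by blast+
    ultimately show ?thesis
      using that unfolding diagonal_nhds_def by blast
  qed
  have int: "E \<inter> F \<in> diagonal_nhds T" if EF: "E \<in> diagonal_nhds T" "F \<in> diagonal_nhds T" for E F
  proof -
    obtain W W' where "openin (prod_topology T T) W" "Id_on ?X \<subseteq> W" "W \<subseteq> E"
      "openin (prod_topology T T) W'" "Id_on ?X \<subseteq> W'" "W' \<subseteq> F"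
      using EF unfolding diagonal_nhds_def by blast
    then have "openin (prod_topology T T) (W \<inter> W')" "Id_on ?X \<subseteq> W \<inter> W'" "W \<inter> W' \<subseteq> E \<inter> F"
      by blast+
    then show ?thesis
      using that unfolding diagonal_nhds_def by blast
  qed
  have top: "?X \<times> ?X \<in> diagonal_nhds T"
  proof -
    have "openin (prod_topology T T) (?X \<times> ?X)"
      by (simp add: openin_prod_Times_iff)
    then show ?thesis
      unfolding diagonal_nhds_def by blast
  qed
  have up: "F \<in> diagonal_nhds T" if "E \<in> diagonal_nhds T" "E \<subseteq> F" "F \<subseteq> ?X \<times> ?X" for E F
    using that unfolding diagonal_nhds_def by blast
  show ?thesis
    unfolding is_uniformity_def
  proof (intro conjI ballI allI impI)
    show "?X \<times> ?X \<in> diagonal_nhds T"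
      by (rule top)
    fix E
    assume E: "E \<in> diagonal_nhds T"
    show "Id_on ?X \<subseteq> E" "E \<subseteq> ?X \<times> ?X"
      using E unfolding diagonal_nhds_def by blast+
    show "E\<inverse> \<in> diagonal_nhds T"
      by (rule inv[OF E])
    show "\<exists>F\<in>diagonal_nhds T. F O F \<subseteq> E"
      by (rule comp[OF E])
    fix F
    show "E \<inter> F \<in> diagonal_nhds T" if "F \<in> diagonal_nhds T"
      by (rule int[OF E that])
    show "F \<in> diagonal_nhds T" if "E \<subseteq> F \<and> F \<subseteq> ?X \<times> ?X"
      using up[OF E] that by simp
  qed
qed

lemma uniform_topology_diagonal_nhds:
  assumes "compact_space T" "Hausdorff_space T"
  shows "uniform_topology (topspace T) (diagonal_nhds T) = T"
  unfolding topology_eq openin_uniform_topology[OF is_uniformity_diagonal_nhds[OF assms]]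
proof (intro allI iffI conjI ballI)
  let ?X = "topspace T"
  fix S
  assume S: "openin T S"
  show "S \<subseteq> ?X"
    using S by (rule openin_subset)
  fix x
  assume x: "x \<in> S"
  have "closedin T {x}"
    using Hausdorff_imp_t1_space[OF assms(2)] x \<open>S \<subseteq> ?X\<close>
    by (auto simp: t1_space_closedin_singleton)
  then have "openin T (?X - {x})"
    by blast
  then have "openin (prod_topology T T) ((?X - {x}) \<times> ?X \<union> ?X \<times> S)" (is "openin _ ?E")
    using S by (intro openin_Un) (auto simp: openin_prod_Times_iff)
  moreover have "Id_on ?X \<subseteq> ?E" "?E \<subseteq> ?X \<times> ?X"
    using x \<open>S \<subseteq> ?X\<close> by blast+
  ultimately have "?E \<in> diagonal_nhds T"
    unfolding diagonal_nhds_def by blast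
  moreover have "?E `` {x} \<subseteq> S"
    by blast
  ultimately show "\<exists>E\<in>diagonal_nhds T. E `` {x} \<subseteq> S"
    by blast
next
  let ?X = "topspace T"
  fix S
  assume S: "S \<subseteq> ?X \<and> (\<forall>x\<in>S. \<exists>E\<in>diagonal_nhds T. E `` {x} \<subseteq> S)"
  have "\<exists>Q. openin T Q \<and> x \<in> Q \<and> Q \<subseteq> S" if x: "x \<in> S" for x
  proof -
    obtain E W where W: "openin (prod_topology T T) W" "Id_on ?X \<subseteq> W" "W \<subseteq> E" "E `` {x} \<subseteq> S"
      using S x unfolding diagonal_nhds_def by blast
    have "(x, x) \<in> W"
      using W(2) S x by blast
    then obtain P Q where "openin T P" "openin T Q" "x \<in> P" "x \<in> Q" "P \<times> Q \<subseteq> W"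
      using W(1) unfolding openin_prod_topology_alt by meson
    then show ?thesis
      using W(3,4) by blast
  qed
  then show "openin T S"
    by (subst openin_subopen) blast
qed

lemma compact_uniformity_unique:
  assumes "compact_space T" and U: "is_uniformity (topspace T) \<U>"
    and top: "uniform_topology (topspace T) \<U> = T"
  shows "\<U> = diagonal_nhds T"
proof (intro equalityI subsetI)
  let ?X = "topspace T"
  fix E
  assume E: "E \<in> \<U>"
  obtain F where F: "F \<in> \<U>" "F O F \<subseteq> E"
    using is_uniformityD(7)[OF U E] by blast
  define G where "G = F \<inter> F\<inverse>"
  have G: "G \<in> \<U>"
    unfolding G_def by (intro is_uniformityD(5)[OF U] is_uniformityD(6)[OF U] F(1))
  have "\<exists>N. openin T N \<and> x \<in> N \<and> N \<subseteq> G `` {x}" if "x \<in> ?X" for x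
    using uniform_neighbourhood[OF U G that] top by simp
  then obtain N where N: "\<And>x. x \<in> ?X \<Longrightarrow> openin T (N x) \<and> x \<in> N x \<and> N x \<subseteq> G `` {x}"
    by metis
  define W where "W = (\<Union>x\<in>?X. N x \<times> N x)"
  have "openin (prod_topology T T) W"
    unfolding W_def using N by (intro openin_Union) (auto simp: openin_prod_Times_iff)
  moreover have "Id_on ?X \<subseteq> W"
    unfolding W_def using N by blast
  moreover have "W \<subseteq> E"
  proof
    fix z
    assume "z \<in> W"
    then obtain x a b where z: "z = (a, b)" "x \<in> ?X" "a \<in> N x" "b \<in> N x"
      unfolding W_def by blast
    then have "(x, a) \<in> G" "(x, b) \<in> G"
      using N by blast+
    then show "z \<in> E"
      using F(2) z unfolding G_def by blast
  qed
  moreover have "E \<subseteq> ?X \<times> ?X"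
    by (rule is_uniformityD(3)[OF U E])
  ultimately show "E \<in> diagonal_nhds T"
    unfolding diagonal_nhds_def by blast
next
  let ?X = "topspace T"
  fix E
  assume "E \<in> diagonal_nhds T"
  then obtain W where W: "openin (prod_topology T T) W" "Id_on ?X \<subseteq> W" "W \<subseteq> E"
    and EX: "E \<subseteq> ?X \<times> ?X"
    unfolding diagonal_nhds_def by blast
  have int: "E \<inter> F \<in> \<U>" if "E \<in> \<U>" "F \<in> \<U>" for E F
    by (rule is_uniformityD(5)[OF U that])
  have "\<exists>D N. D \<in> \<U> \<and> openin T N \<and> x \<in> N \<and> N \<subseteq> D `` {x} \<and> (D O D) `` {x} \<times> (D O D) `` {x} \<subseteq> W"
    if x: "x \<in> ?X" for x
  proof -
    have "(x, x) \<in> W"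
      using W(2) x by blast
    then obtain P Q where PQ: "openin T P" "openin T Q" "x \<in> P" "x \<in> Q" "P \<times> Q \<subseteq> W"
      using W(1) unfolding openin_prod_topology_alt by meson
    then have "openin (uniform_topology ?X \<U>) (P \<inter> Q)"
      using top by auto
    then obtain F where F: "F \<in> \<U>" "F `` {x} \<subseteq> P \<inter> Q"
      unfolding openin_uniform_topology[OF U] using PQ by blast
    obtain D where D: "D \<in> \<U>" "D O D \<subseteq> F"
      using is_uniformityD(7)[OF U F(1)] by blast
    obtain N where "openin T N" "x \<in> N" "N \<subseteq> D `` {x}"
      using uniform_neighbourhood[OF U D(1) x] top by auto
    moreover have "(D O D) `` {x} \<times> (D O D) `` {x} \<subseteq> W"
      using D F PQ by blast
    ultimately show ?thesis
      using D(1) by blast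
  qed
  then obtain D N where DN: "\<And>x. x \<in> ?X \<Longrightarrow> D x \<in> \<U> \<and> openin T (N x) \<and> x \<in> N x
      \<and> N x \<subseteq> D x `` {x} \<and> (D x O D x) `` {x} \<times> (D x O D x) `` {x} \<subseteq> W"
    by metis
  have "compactin T ?X"
    using assms(1) by (simp add: compact_space_def)
  moreover have "\<forall>V \<in> N ` ?X. openin T V" "?X \<subseteq> \<Union>(N ` ?X)"
    using DN by blast+
  ultimately obtain \<F> where "finite \<F>" "\<F> \<subseteq> N ` ?X" "?X \<subseteq> \<Union>\<F>"
    unfolding compactin_def by meson
  then obtain J where J: "finite J" "J \<subseteq> ?X" "?X \<subseteq> \<Union>(N ` J)"
    by (metis finite_subset_image)
  have "(?X \<times> ?X) \<inter> \<Inter>(D ` J) \<in> \<U>" (is "?F \<in> \<U>")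
    using J(1,2)
  proof (induction J rule: finite_induct)
    case empty
    then show ?case
      using is_uniformityD(1)[OF U] by simp
  next
    case (insert j J)
    then have "D j \<in> \<U>" "(?X \<times> ?X) \<inter> \<Inter>(D ` J) \<in> \<U>"
      using DN by auto
    then have "D j \<inter> ((?X \<times> ?X) \<inter> \<Inter>(D ` J)) \<in> \<U>"
      by (rule int)
    then show ?case
      by (simp add: Int_left_commute)
  qed
  moreover have "?F \<subseteq> E"
  proof
    fix z
    assume z: "z \<in> ?F"
    obtain a b where ab: "z = (a, b)" "a \<in> ?X"
      using z by blast
    then obtain j where j: "j \<in> J" "a \<in> N j"
      using J(3) by blast
    have jX: "j \<in> ?X"
      using j J by blast
    have aD: "(j, a) \<in> D j" "(a, b) \<in> D j"
      using DN[OF jX] j z ab by blast+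
    have "(a, a) \<in> D j"
      using is_uniformityD(2)[OF U] DN[OF jX] ab(2) by blast
    then have "a \<in> (D j O D j) `` {j}" "b \<in> (D j O D j) `` {j}"
      using aD by blast+
    then show "z \<in> E"
      using DN[OF jX] W(3) ab(1) by blast
  qed
  ultimately show "E \<in> \<U>"
    using is_uniformityD(4)[OF U _ _ EX] by blast
qed

lemma ex1_compact_uniformity:
  assumes "compact_space T" "Hausdorff_space T"
  shows "\<exists>!\<U>. is_uniformity (topspace T) \<U> \<and> uniform_topology (topspace T) \<U> = T"
proof (rule ex1I)
  show "is_uniformity (topspace T) (diagonal_nhds T) \<and>
      uniform_topology (topspace T) (diagonal_nhds T) = T"
    by (intro conjI is_uniformity_diagonal_nhds uniform_topology_diagonal_nhds assms)
next
  fix \<U>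
  assume "is_uniformity (topspace T) \<U> \<and> uniform_topology (topspace T) \<U> = T"
  then show "\<U> = diagonal_nhds T"
    by (elim conjE) (rule compact_uniformity_unique[OF assms(1)])
qed


section \<open>Directed graphs\<close>

record 'a dgraph =
  elems :: "'a set"
  verts :: "'a set"
  src :: "'a \<Rightarrow> 'a"
  tgt :: "'a \<Rightarrow> 'a"

definition directed_graph :: "'a dgraph \<Rightarrow> bool" where
  "directed_graph G \<longleftrightarrow>
     verts G \<subseteq> elems G \<and>
     src G \<in> elems G \<rightarrow> verts G \<and> tgt G \<in> elems G \<rightarrow> verts G \<and>
     (\<forall>x\<in>verts G. src G x = x \<and> tgt G x = x)"

definition sub_dgraph :: "'a set \<Rightarrow> 'a dgraph \<Rightarrow> bool" where
  "sub_dgraph H G \<longleftrightarrow> H \<subseteq> elems G \<and> (\<forall>x\<in>H. src G x \<in> H \<and> tgt G x \<in> H)"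

text \<open>Vertices are the fixed points of the source map, so that preservation of sources and
  targets already entails that vertices are mapped to vertices, and that an injective map
  identifies the vertices of \<open>G\<close> with those of its image.\<close>

definition dgraph_map :: "('a \<Rightarrow> 'b) \<Rightarrow> 'a dgraph \<Rightarrow> 'b dgraph \<Rightarrow> bool" where
  "dgraph_map f G H \<longleftrightarrow>
     f \<in> elems G \<rightarrow> elems H \<and>
     (\<forall>x\<in>elems G. f (src G x) = src H (f x) \<and> f (tgt G x) = tgt H (f x))"

definition dgraph_iso :: "('a \<Rightarrow> 'b) \<Rightarrow> 'a dgraph \<Rightarrow> 'b dgraph \<Rightarrow> bool" where
  "dgraph_iso f G H \<longleftrightarrow> dgraph_map f G H \<and> bij_betw f (elems G) (elems H)"

definition topological_dgraph :: "'a dgraph \<Rightarrow> 'a topology \<Rightarrow> bool" where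
  "topological_dgraph G T \<longleftrightarrow>
     directed_graph G \<and> topspace T = elems G \<and>
     continuous_map T (subtopology T (verts G)) (src G) \<and>
     continuous_map T (subtopology T (verts G)) (tgt G)"

definition topological_dgraph_iso ::
    "('a \<Rightarrow> 'b) \<Rightarrow> 'a dgraph \<Rightarrow> 'a topology \<Rightarrow> 'b dgraph \<Rightarrow> 'b topology \<Rightarrow> bool" where
  "topological_dgraph_iso f G T H S \<longleftrightarrow> dgraph_iso f G H \<and> homeomorphic_map T S f"


section \<open>Cofinite directed graphs and completions\<close>

definition compatible_equiv :: "'a dgraph \<Rightarrow> ('a \<times> 'a) set \<Rightarrow> bool" where
  "compatible_equiv G R \<longleftrightarrow>
     equiv (elems G) R \<and>
     (\<forall>(x, y)\<in>R. (src G x, src G y) \<in> R \<and> (tgt G x, tgt G y) \<in> R)"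

definition cofinite_entourage ::
    "'a dgraph \<Rightarrow> ('a \<times> 'a) set set \<Rightarrow> ('a \<times> 'a) set \<Rightarrow> bool" where
  "cofinite_entourage G \<U> R \<longleftrightarrow>
     R \<in> \<U> \<and> compatible_equiv G R \<and> finite (elems G // R)"

definition cofinite_dgraph :: "'a dgraph \<Rightarrow> ('a \<times> 'a) set set \<Rightarrow> bool" where
  "cofinite_dgraph G \<U> \<longleftrightarrow>
     directed_graph G \<and> is_hausdorff_uniformity (elems G) \<U> \<and>
     (\<forall>E\<in>\<U>. \<exists>R. cofinite_entourage G \<U> R \<and> R \<subseteq> E)"

text \<open>\<open>(D, T)\<close> is a completion of \<open>(G, \<U>)\<close>, where \<open>G\<close> is identified with a subgraph of \<open>D\<close>
  by means of the injective map \<open>i\<close>: the carrier of \<open>D\<close> is in general too large for the type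
  of \<open>G\<close>. For \<open>elems G \<subseteq> elems D\<close> in the same type, take \<open>i\<close> to be the identity. The points of a
  completion can always be encoded as filters on \<open>elems G\<close>, i.e. in the type \<open>'a set set\<close>.\<close>

definition dgraph_completion ::
    "'a dgraph \<Rightarrow> ('a \<times> 'a) set set \<Rightarrow> 'b dgraph \<Rightarrow> 'b topology \<Rightarrow> ('a \<Rightarrow> 'b) \<Rightarrow> bool" where
  "dgraph_completion G \<U> D T i \<longleftrightarrow>
     topological_dgraph D T \<and> compact_space T \<and> Hausdorff_space T \<and>
     dgraph_map i G D \<and> inj_on i (elems G) \<and> sub_dgraph (i ` elems G) D \<and>
     T closure_of (i ` elems G) = elems D \<and>
     \<U> = induced_uniformity i (elems G) (compact_uniformity T)"

end

theory Submission
  imports Defs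
begin

text \<open>Existence: the sets saturated for some cofinite entourage form a Boolean algebra, and the
  completion is its Stone space. Source and target act on ultrafilters by taking preimages, because
  cofinite entourages are compatible; the entourages extend to ultrafilters by comparing them on the
  saturated sets.

  Uniqueness: the closure of \<open>{(i1 x, i2 x) | x \<in> G}\<close> in the product of two completions
  projects bijectively onto both factors since both induce the uniformity of \<open>G\<close>. The
  projections are homeomorphisms by compactness, so this closure is the graph of the isomorphism.\<close>

section \<open>Uniqueness\<close>

lemma compact_uniformity_eq_diagonal_nhds:
  assumes "compact_space T" "Hausdorff_space T"
  shows "compact_uniformity T = diagonal_nhds T"
  unfolding compact_uniformity_def
proof (rule the_equality)
  show "is_uniformity (topspace T) (diagonal_nhds T) \<and>
      uniform_topology (topspace T) (diagonal_nhds T) = T"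
    by (intro conjI is_uniformity_diagonal_nhds uniform_topology_diagonal_nhds assms)
qed (use compact_uniformity_unique[OF assms(1)] in blast)

text \<open>The diagonal is closed in the square, which is compact Hausdorff and hence regular, so
  the diagonal and the point \<open>(b, b')\<close> have disjoint open neighbourhoods. The first is
  the entourage; the second is shrunk to a rectangle.\<close>

lemma diagonal_nhds_separation:
  assumes "compact_space T" "Hausdorff_space T"
    and "b \<in> topspace T" "b' \<in> topspace T" "b \<noteq> b'"
  obtains F P Q where "F \<in> diagonal_nhds T" "openin T P" "openin T Q" "b \<in> P" "b' \<in> Q"
    "F \<inter> P \<times> Q = {}"
proof -
  let ?d = "(\<lambda>x. (x, x)) ` topspace T"
  have "regular_space (prod_topology T T)"
    using assms by (simp add: compact_Hausdorff_imp_regular_space compact_space_prod_topology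
        Hausdorff_space_prod_topology)
  moreover have "closedin (prod_topology T T) ?d"
    using assms(2) by (simp add: Hausdorff_space_closedin_diagonal)
  moreover have "(b, b') \<in> topspace (prod_topology T T) - ?d"
    using assms by auto
  ultimately obtain N W where N: "openin (prod_topology T T) N" "(b, b') \<in> N"
    and W: "openin (prod_topology T T) W" "?d \<subseteq> W" and dis: "disjnt N W"
    unfolding regular_space_def by meson
  obtain P Q where PQ: "openin T P" "openin T Q" "b \<in> P" "b' \<in> Q" "P \<times> Q \<subseteq> N"
    using N unfolding openin_prod_topology_alt by meson
  have "W \<subseteq> topspace T \<times> topspace T"
    using openin_subset[OF W(1)] by simp
  then have "W \<in> diagonal_nhds T"
    using W unfolding diagonal_nhds_def by blast
  moreover have "W \<inter> P \<times> Q = {}"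
    using PQ(5) dis unfolding disjnt_def by blast
  ultimately show thesis
    using that PQ by blast
qed

section \<open>Matched points of two compact spaces\<close>

text \<open>Points of two compact spaces are matched when they are limits of a common net in \<open>X\<close>.\<close>

definition matching ::
    "'a set \<Rightarrow> ('a \<Rightarrow> 'b) \<Rightarrow> 'b topology \<Rightarrow> ('a \<Rightarrow> 'c) \<Rightarrow> 'c topology \<Rightarrow> ('b \<times> 'c) set" where
  "matching X f S g T = prod_topology S T closure_of (\<lambda>x. (f x, g x)) ` X"

text \<open>Open rectangles suffice to test a closure in the product. This form yields a single
  \<open>x\<close> approximating both coordinates at once.\<close>

lemma in_matching:
  "(a, b) \<in> matching X f S g T \<longleftrightarrow> a \<in> topspace S \<and> b \<in> topspace T \<and>
     (\<forall>P Q. openin S P \<and> openin T Q \<and> a \<in> P \<and> b \<in> Q \<longrightarrow> (\<exists>x\<in>X. f x \<in> P \<and> g x \<in> Q))"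
    (is "?l \<longleftrightarrow> ?r")
proof
  assume ?l
  then have *: "a \<in> topspace S" "b \<in> topspace T"
    "\<And>N. (a, b) \<in> N \<Longrightarrow> openin (prod_topology S T) N \<Longrightarrow> \<exists>x\<in>X. (f x, g x) \<in> N"
    unfolding matching_def in_closure_of by auto
  have "\<exists>x\<in>X. f x \<in> P \<and> g x \<in> Q" if "openin S P" "openin T Q" "a \<in> P" "b \<in> Q" for P Q
    using *(3)[of "P \<times> Q"] that by (auto simp: openin_prod_Times_iff)
  then show ?r
    using * by blast
next
  assume r: ?r
  have "\<exists>y. y \<in> (\<lambda>x. (f x, g x)) ` X \<and> y \<in> N"
    if N: "(a, b) \<in> N" "openin (prod_topology S T) N" for N
  proof -
    obtain P Q where PQ: "openin S P" "openin T Q" "a \<in> P" "b \<in> Q" "P \<times> Q \<subseteq> N"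
      using N unfolding openin_prod_topology_alt by meson
    then obtain x where "x \<in> X" "f x \<in> P" "g x \<in> Q"
      using r by blast
    then show ?thesis
      using PQ(5) by blast
  qed
  then show ?l
    unfolding matching_def in_closure_of using r by auto
qed

lemma matching_commute: "(a, b) \<in> matching X f S g T \<longleftrightarrow> (b, a) \<in> matching X g T f S"
  unfolding in_matching by blast

text \<open>If \<open>b\<close> and \<open>b'\<close> were distinct, an entourage \<open>F\<close>
  of \<open>T\<close> would keep points near \<open>b\<close> apart from points near
  \<open>b'\<close>. But elements of \<open>X\<close> with \<open>f\<close>-images near
  \<open>a\<close> have close \<open>f\<close>-images, hence \<open>F\<close>-close
  \<open>g\<close>-images, since \<open>g\<close> induces no more entourages on \<open>X\<close>
  than \<open>f\<close> does.\<close>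

lemma matching_unique:
  assumes S: "compact_space S" "Hausdorff_space S" and T: "compact_space T" "Hausdorff_space T"
    and uni: "induced_uniformity g X (compact_uniformity T) \<subseteq>
      induced_uniformity f X (compact_uniformity S)"
    and "(a, b) \<in> matching X f S g T" "(a, b') \<in> matching X f S g T"
  shows "b = b'"
proof (rule ccontr)
  assume "b \<noteq> b'"
  moreover have a: "a \<in> topspace S" and b: "b \<in> topspace T" "b' \<in> topspace T"
    using assms(6,7) unfolding in_matching by blast+
  ultimately obtain F Q Q' where F: "F \<in> diagonal_nhds T"
    and Q: "openin T Q" "openin T Q'" "b \<in> Q" "b' \<in> Q'" "F \<inter> Q \<times> Q' = {}"
    using diagonal_nhds_separation[OF T] by metis
  \<comment> \<open>Induced uniformities consist of exact traces, so the trace of \<open>F\<close>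
    along \<open>g\<close> equals the trace along \<open>f\<close> of some entourage
    \<open>E\<close>.\<close>
  have "{(x, y). x \<in> X \<and> y \<in> X \<and> (g x, g y) \<in> F} \<in> induced_uniformity f X (compact_uniformity S)"
    using F uni unfolding induced_uniformity_def compact_uniformity_eq_diagonal_nhds[OF T] by blast
  then obtain E where E: "E \<in> diagonal_nhds S"
    and EF: "{(x, y). x \<in> X \<and> y \<in> X \<and> (g x, g y) \<in> F} = {(x, y). x \<in> X \<and> y \<in> X \<and> (f x, f y) \<in> E}"
    unfolding induced_uniformity_def compact_uniformity_eq_diagonal_nhds[OF S] by blast
  obtain W where W: "openin (prod_topology S S) W" "Id_on (topspace S) \<subseteq> W" "W \<subseteq> E"
    using E unfolding diagonal_nhds_def by blast
  have "(a, a) \<in> W"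
    using a W(2) by blast
  then obtain P P' where P: "openin S P" "openin S P'" "a \<in> P" "a \<in> P'" "P \<times> P' \<subseteq> W"
    using W(1) unfolding openin_prod_topology_alt by meson
  obtain x where x: "x \<in> X" "f x \<in> P" "g x \<in> Q"
    using assms(6) P Q unfolding in_matching by blast
  obtain y where y: "y \<in> X" "f y \<in> P'" "g y \<in> Q'"
    using assms(7) P Q unfolding in_matching by blast
  have "(x, y) \<in> {(x, y). x \<in> X \<and> y \<in> X \<and> (f x, f y) \<in> E}"
    using x y P W by blast
  then have "(g x, g y) \<in> F"
    unfolding EF[symmetric] by blast
  then show False
    using x y Q by blast
qed

lemma compactin_matching:
  assumes "compact_space S" "compact_space T"
  shows "compactin (prod_topology S T) (matching X f S g T)"
  unfolding matching_def
  by (rule closedin_compact_space) (use assms in \<open>auto simp: compact_space_prod_topology\<close>)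

lemma fst_matching:
  assumes S: "compact_space S" "Hausdorff_space S" and T: "compact_space T"
    and "g \<in> X \<rightarrow> topspace T" and dense: "S closure_of (f ` X) = topspace S" and "f \<in> X \<rightarrow> topspace S"
  shows "fst ` matching X f S g T = topspace S"
proof
  have "compactin S (fst ` matching X f S g T)"
    by (rule image_compactin[OF compactin_matching[OF S(1) T] continuous_map_fst])
  then have "closedin S (fst ` matching X f S g T)"
    using S(2) compactin_imp_closedin by blast
  moreover have "(\<lambda>x. (f x, g x)) ` X \<subseteq> matching X f S g T"
    unfolding matching_def by (rule closure_of_subset) (use assms in auto)
  then have "f ` X \<subseteq> fst ` matching X f S g T"
    by force
  ultimately show "topspace S \<subseteq> fst ` matching X f S g T"
    using closure_of_minimal dense by metis
qed (auto simp: in_matching)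

text \<open>A continuous bijection from a compact space onto a Hausdorff space is a homeomorphism;
  injectivity is \<open>matching_unique\<close>, surjectivity is
  \<open>fst_matching\<close>.\<close>

lemma homeomorphic_map_fst_matching:
  assumes S: "compact_space S" "Hausdorff_space S" and T: "compact_space T" "Hausdorff_space T"
    and "g \<in> X \<rightarrow> topspace T" "f \<in> X \<rightarrow> topspace S" "S closure_of (f ` X) = topspace S"
    and "induced_uniformity g X (compact_uniformity T) \<subseteq>
      induced_uniformity f X (compact_uniformity S)"
  shows "homeomorphic_map (subtopology (prod_topology S T) (matching X f S g T)) S fst"
proof (rule continuous_imp_homeomorphic_map)
  let ?K = "matching X f S g T"
  have top: "topspace (subtopology (prod_topology S T) ?K) = ?K"
    using in_matching[of _ _ X f S g T] by (auto simp: topspace_subtopology)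
  show "compact_space (subtopology (prod_topology S T) ?K)"
    by (rule compact_space_subtopology[OF compactin_matching[OF S(1) T(1)]])
  show "continuous_map (subtopology (prod_topology S T) ?K) S fst"
    by (intro continuous_map_from_subtopology continuous_map_fst)
  show "fst ` topspace (subtopology (prod_topology S T) ?K) = topspace S"
    unfolding top by (rule fst_matching) (use assms in auto)
  show "inj_on fst (topspace (subtopology (prod_topology S T) ?K))"
    unfolding top using matching_unique[OF S T assms(8)] by (auto simp: inj_on_def)
qed (rule assms)

text \<open>Both projections must start from the same space, so only the pointwise facts,
  surjectivity and injectivity, are transferred by swapping the factors.\<close>

lemma homeomorphic_map_snd_matching:
  assumes S: "compact_space S" "Hausdorff_space S" and T: "compact_space T" "Hausdorff_space T"
    and "g \<in> X \<rightarrow> topspace T" "f \<in> X \<rightarrow> topspace S" "T closure_of (g ` X) = topspace T"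
    and "induced_uniformity f X (compact_uniformity S) \<subseteq>
      induced_uniformity g X (compact_uniformity T)"
  shows "homeomorphic_map (subtopology (prod_topology S T) (matching X f S g T)) T snd"
proof (rule continuous_imp_homeomorphic_map)
  let ?K = "matching X f S g T"
  have top: "topspace (subtopology (prod_topology S T) ?K) = ?K"
    using in_matching[of _ _ X f S g T] by (auto simp: topspace_subtopology)
  show "compact_space (subtopology (prod_topology S T) ?K)"
    by (rule compact_space_subtopology[OF compactin_matching[OF S(1) T(1)]])
  show "continuous_map (subtopology (prod_topology S T) ?K) T snd"
    by (intro continuous_map_from_subtopology continuous_map_snd)
  have "snd ` ?K = fst ` matching X g T f S"
    using matching_commute[of _ _ X f S g T] by force
  then show "snd ` topspace (subtopology (prod_topology S T) ?K) = topspace T"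
    unfolding top using fst_matching[OF T S(1)] assms by metis
  show "inj_on snd (topspace (subtopology (prod_topology S T) ?K))"
    unfolding top using matching_unique[OF T S assms(8)] matching_commute[of _ _ X f S g T]
    by (auto simp: inj_on_def)
qed (rule assms)

text \<open>The product of \<open>p\<close> and \<open>q\<close> is continuous and sends the pair
  given by \<open>x\<close> to the pair given by \<open>r x\<close>, so it preserves the closure of
  these pairs. It will be applied to source and target maps.\<close>

lemma matching_map:
  assumes "continuous_map S S p" "continuous_map T T q" "\<And>x. x \<in> X \<Longrightarrow> r x \<in> X"
    and "\<And>x. x \<in> X \<Longrightarrow> p (f x) = f (r x)" "\<And>x. x \<in> X \<Longrightarrow> q (g x) = g (r x)"
    and "(a, b) \<in> matching X f S g T"
  shows "(p a, q b) \<in> matching X f S g T"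
  unfolding in_matching
proof (intro conjI allI impI)
  have ab: "a \<in> topspace S" "b \<in> topspace T"
    using assms(6) unfolding in_matching by blast+
  then show "p a \<in> topspace S" "q b \<in> topspace T"
    using assms(1,2) by (auto simp: continuous_map_def)
  fix P Q
  assume PQ: "openin S P \<and> openin T Q \<and> p a \<in> P \<and> q b \<in> Q"
  have "openin S {x \<in> topspace S. p x \<in> P}" "openin T {x \<in> topspace T. q x \<in> Q}"
    using PQ assms(1,2) by (auto simp: continuous_map_def)
  then obtain x where "x \<in> X" "f x \<in> {x \<in> topspace S. p x \<in> P}" "g x \<in> {x \<in> topspace T. q x \<in> Q}"
    using assms(6) ab PQ unfolding in_matching by fastforce
  then show "\<exists>x\<in>X. f x \<in> P \<and> g x \<in> Q"
    using assms(3-5) by (intro bexI[of _ "r x"]) auto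
qed

section \<open>The isomorphism between two completions\<close>

lemma dgraph_completion_unique:
  assumes "directed_graph G" and c1: "dgraph_completion G \<U> D1 T1 i1"
    and c2: "dgraph_completion G \<U> D2 T2 i2"
  shows "\<exists>h. topological_dgraph_iso h D1 T1 D2 T2 \<and> (\<forall>x\<in>elems G. h (i1 x) = i2 x)"
proof -
  let ?X = "elems G" and ?K = "matching (elems G) i1 T1 i2 T2"
  let ?KT = "subtopology (prod_topology T1 T2) ?K"
  note C1 = c1[unfolded dgraph_completion_def topological_dgraph_def dgraph_map_def]
  note C2 = c2[unfolded dgraph_completion_def topological_dgraph_def dgraph_map_def]
  have top: "topspace T1 = elems D1" "topspace T2 = elems D2"
    using C1 C2 by auto
  have i: "i1 \<in> ?X \<rightarrow> topspace T1" "i2 \<in> ?X \<rightarrow> topspace T2"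
    using C1 C2 by auto
  have ch: "compact_space T1" "Hausdorff_space T1" "compact_space T2" "Hausdorff_space T2"
    using C1 C2 by auto
  have dense: "T1 closure_of (i1 ` ?X) = topspace T1" "T2 closure_of (i2 ` ?X) = topspace T2"
    using C1 C2 by auto
  have uni: "induced_uniformity i1 ?X (compact_uniformity T1) =
      induced_uniformity i2 ?X (compact_uniformity T2)"
    using C1 C2 by auto
  have f: "homeomorphic_map ?KT T1 fst"
    by (rule homeomorphic_map_fst_matching) (use ch i dense uni in auto)
  have s: "homeomorphic_map ?KT T2 snd"
    by (rule homeomorphic_map_snd_matching) (use ch i dense uni in auto)
  obtain k where k: "homeomorphic_maps ?KT T1 fst k"
    using f homeomorphic_map_maps by blast
  have topK: "topspace ?KT = ?K"
    using in_matching[of _ _ ?X i1 T1 i2 T2] by (auto simp: topspace_subtopology)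
  \<comment> \<open>Going back along the first projection and out along the second reads the
    matching as a function.\<close>
  define h where "h = snd \<circ> k"
  have h: "homeomorphic_map T1 T2 h"
    unfolding h_def using k s homeomorphic_map_compose homeomorphic_maps_map by blast
  have hK: "h a = b" if "(a, b) \<in> ?K" for a b
    using k that unfolding homeomorphic_maps_map topK h_def by force
  have Kh: "(a, h a) \<in> ?K" if "a \<in> topspace T1" for a
  proof -
    have "a \<in> fst ` ?K"
      using homeomorphic_imp_surjective_map[OF f] that unfolding topK by blast
    then obtain b where "(a, b) \<in> ?K"
      by force
    then show ?thesis
      using hK by blast
  qed
  have inG: "src G x \<in> ?X" "tgt G x \<in> ?X" if "x \<in> ?X" for x
    using assms(1) that unfolding directed_graph_def by auto
  have cont: "continuous_map T1 T1 (src D1)" "continuous_map T1 T1 (tgt D1)"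
      "continuous_map T2 T2 (src D2)" "continuous_map T2 T2 (tgt D2)"
    using C1 C2 continuous_map_in_subtopology by blast+
  have bij: "bij_betw h (elems D1) (elems D2)"
    unfolding bij_betw_def top[symmetric]
    using homeomorphic_imp_injective_map[OF h] homeomorphic_imp_surjective_map[OF h] by blast
  have "h (src D1 a) = src D2 (h a)" if "a \<in> topspace T1" for a
  \<comment> \<open>By \<open>hK\<close> the equation reduces to membership of
    \<open>(src D1 a, src D2 (h a))\<close> in the matching, which the source maps preserve.\<close>
  proof (rule hK, rule matching_map[OF _ _ _ _ _ Kh[OF that], where r = "src G"])
    show "continuous_map T1 T1 (src D1)" "continuous_map T2 T2 (src D2)"
      by (rule cont)+
  qed (use inG C1 C2 in auto)
  moreover have "h (tgt D1 a) = tgt D2 (h a)" if "a \<in> topspace T1" for a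
  proof (rule hK, rule matching_map[OF _ _ _ _ _ Kh[OF that], where r = "tgt G"])
    show "continuous_map T1 T1 (tgt D1)" "continuous_map T2 T2 (tgt D2)"
      by (rule cont)+
  qed (use inG C1 C2 in auto)
  ultimately have "dgraph_map h D1 D2"
    unfolding dgraph_map_def top using bij_betwE[OF bij] by blast
  with bij h have "topological_dgraph_iso h D1 T1 D2 T2"
    by (simp add: topological_dgraph_iso_def dgraph_iso_def)
  moreover have "h (i1 x) = i2 x" if "x \<in> ?X" for x
  proof (rule hK)
    have "(\<lambda>x. (i1 x, i2 x)) ` ?X \<subseteq> ?K"
      unfolding matching_def by (rule closure_of_subset) (use i in auto)
    then show "(i1 x, i2 x) \<in> ?K"
      using that by blast
  qed
  ultimately show ?thesis
    by blast
qed

section \<open>Existence\<close>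

lemma cofinite_entourageD:
  assumes "cofinite_entourage G \<U> R"
  shows "R \<in> \<U>" "equiv (elems G) R" "finite (elems G // R)"
  using assms unfolding cofinite_entourage_def compatible_equiv_def by auto

locale cofinite =
  fixes G :: "'a dgraph" and \<U> :: "('a \<times> 'a) set set"
  assumes cofinite: "cofinite_dgraph G \<U>"
begin

section \<open>The Stone space of saturated sets: definitions\<close>

abbreviation X :: "'a set" where "X \<equiv> elems G"
abbreviation cofin :: "('a \<times> 'a) set \<Rightarrow> bool" where "cofin \<equiv> cofinite_entourage G \<U>"

text \<open>For an equivalence relation \<open>R\<close> on \<open>X\<close> these are the unions of
  \<open>R\<close>-classes.\<close>

definition saturated :: "('a \<times> 'a) set \<Rightarrow> 'a set set" where
  "saturated R = {A. A \<subseteq> X \<and> R `` A \<subseteq> A}"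

definition algebra_sets :: "'a set set" where
  "algebra_sets = (\<Union>R\<in>Collect cofin. saturated R)"

text \<open>The ultrafilters of the Boolean algebra \<open>algebra_sets\<close>. Properness and
  upward closure follow from the complement clause, see \<open>points_nonempty\<close> and
  \<open>points_upward\<close>.\<close>

definition points :: "'a set set set" where
  "points = {p. p \<subseteq> algebra_sets \<and> X \<in> p \<and> (\<forall>A\<in>p. \<forall>B\<in>p. A \<inter> B \<in> p) \<and>
     (\<forall>A\<in>algebra_sets. X - A \<in> p \<longleftrightarrow> A \<notin> p)}"

text \<open>The extension of \<open>R\<close> to ultrafilters; \<open>point_of_same_on\<close> shows
  that it restricts to \<open>R\<close> on \<open>X\<close> for every cofinite entourage
  \<open>R\<close>.\<close>

definition same_on :: "('a \<times> 'a) set \<Rightarrow> ('a set set \<times> 'a set set) set" where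
  "same_on R = {(p, q) \<in> points \<times> points. \<forall>A\<in>saturated R. A \<in> p \<longleftrightarrow> A \<in> q}"

definition point_uniformity :: "('a set set \<times> 'a set set) set set" where
  "point_uniformity = {F. F \<subseteq> points \<times> points \<and> (\<exists>R. cofin R \<and> same_on R \<subseteq> F)}"

definition point_topology :: "'a set set topology" where
  "point_topology = uniform_topology points point_uniformity"

definition point_of :: "'a \<Rightarrow> 'a set set" where
  "point_of x = {A \<in> algebra_sets. x \<in> A}"

text \<open>The image ultrafilter under \<open>f\<close>. Membership in the algebra is demanded
  separately, since a set outside the algebra may have a preimage inside it.\<close>

definition push :: "('a \<Rightarrow> 'a) \<Rightarrow> 'a set set \<Rightarrow> 'a set set" where
  "push f p = {A \<in> algebra_sets. {x \<in> X. f x \<in> A} \<in> p}"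

text \<open>Taking the fixed points of the extended source map as vertices makes them available
  without describing the closure of \<open>verts G\<close>.\<close>

definition completed :: "'a set set dgraph" where
  "completed = \<lparr>elems = points, verts = {p \<in> points. push (src G) p = p},
     src = push (src G), tgt = push (tgt G)\<rparr>"

section \<open>Cofinite entourages and the algebra of saturated sets\<close>

lemma dgraph: "directed_graph G"
  using cofinite unfolding cofinite_dgraph_def by blast

lemma uniformity: "is_uniformity X \<U>"
  using cofinite unfolding cofinite_dgraph_def is_hausdorff_uniformity_def by blast

lemma cofin_below:
  assumes "E \<in> \<U>"
  obtains R where "cofin R" "R \<subseteq> E"
  using cofinite assms unfolding cofinite_dgraph_def by blast

lemma cofin_exists: obtains R where "cofin R"
  using is_uniformityD(1)[OF uniformity] cofin_below by blast

text \<open>The base property is applied to \<open>R \<inter> R'\<close>, which avoids checking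
  compatibility and finite index of the intersection itself.\<close>

lemma cofin_common:
  assumes "cofin R" "cofin R'"
  obtains R'' where "cofin R''" "R'' \<subseteq> R" "R'' \<subseteq> R'"
proof -
  have "R \<inter> R' \<in> \<U>"
    using is_uniformityD(5)[OF uniformity] cofinite_entourageD(1) assms by blast
  then show thesis
    using cofin_below that by (metis le_inf_iff)
qed

lemma saturated_mono: "R \<subseteq> R' \<Longrightarrow> saturated R' \<subseteq> saturated R"
  unfolding saturated_def by blast

lemma algebra_setsI: "cofin R \<Longrightarrow> A \<in> saturated R \<Longrightarrow> A \<in> algebra_sets"
  unfolding algebra_sets_def by blast

lemma algebra_setsE:
  assumes "A \<in> algebra_sets"
  obtains R where "cofin R" "A \<in> saturated R"
  using assms unfolding algebra_sets_def by blast

lemma saturated_Int: "A \<in> saturated R \<Longrightarrow> B \<in> saturated R \<Longrightarrow> A \<inter> B \<in> saturated R"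
  unfolding saturated_def by blast

lemma saturated_compl:
  assumes "cofin R" "A \<in> saturated R"
  shows "X - A \<in> saturated R"
proof -
  have "sym R" "R \<subseteq> X \<times> X"
    using cofinite_entourageD(2)[OF assms(1)] by (auto simp: equiv_def)
  then show ?thesis
    using assms(2) unfolding saturated_def sym_def by blast
qed

lemma saturated_top: "cofin R \<Longrightarrow> X \<in> saturated R"
  using cofinite_entourageD(2)[of G \<U> R] unfolding saturated_def equiv_def by auto

lemma class_saturated:
  assumes "cofin R" "C \<in> X // R"
  shows "C \<in> saturated R"
  using cofinite_entourageD(2)[OF assms(1)] assms(2)
  unfolding saturated_def equiv_def quotient_def by (auto dest: transD)

lemma algebra_sets_top: "X \<in> algebra_sets"
  using cofin_exists algebra_setsI saturated_top by metis

lemma algebra_sets_compl: "A \<in> algebra_sets \<Longrightarrow> X - A \<in> algebra_sets"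
  by (metis algebra_setsE algebra_setsI saturated_compl)

text \<open>The two sets may be saturated for different entourages; both are saturated for a common
  refinement.\<close>

lemma algebra_sets_Int:
  assumes "A \<in> algebra_sets" "B \<in> algebra_sets"
  shows "A \<inter> B \<in> algebra_sets"
proof -
  obtain R R' where R: "cofin R" "A \<in> saturated R" "cofin R'" "B \<in> saturated R'"
    using assms algebra_setsE by metis
  obtain R'' where "cofin R''" "R'' \<subseteq> R" "R'' \<subseteq> R'"
    using cofin_common R by blast
  then show ?thesis
    using R saturated_mono saturated_Int algebra_setsI by (meson subsetD)
qed

lemma algebra_sets_subset: "A \<in> algebra_sets \<Longrightarrow> A \<subseteq> X"
  unfolding algebra_sets_def saturated_def by blast

section \<open>Ultrafilters of the algebra\<close>

lemma pointsD:
  assumes "p \<in> points"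
  shows "A \<in> p \<Longrightarrow> A \<in> algebra_sets" "X \<in> p" "A \<in> p \<Longrightarrow> B \<in> p \<Longrightarrow> A \<inter> B \<in> p"
    "A \<in> algebra_sets \<Longrightarrow> X - A \<in> p \<longleftrightarrow> A \<notin> p"
  using assms unfolding points_def by auto

lemma points_nonempty:
  assumes "p \<in> points"
  shows "{} \<notin> p"
  using pointsD(2)[OF assms] pointsD(4)[OF assms algebra_sets_top] by auto

lemma points_upward:
  assumes p: "p \<in> points" and "A \<in> p" "A \<subseteq> B" "B \<in> algebra_sets"
  shows "B \<in> p"
proof (rule ccontr)
  assume "B \<notin> p"
  then have "A \<inter> (X - B) \<in> p"
    using pointsD[OF p] assms by blast
  moreover have "A \<inter> (X - B) = {}"
    using assms(3) by blast
  ultimately show False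
    using points_nonempty[OF p] by simp
qed

text \<open>Ultrafilters are prime: if no member of the family were in \<open>p\<close>, all
  complements would be, and so would their finite intersection, which is disjoint from the
  union.\<close>

lemma points_finite_Union:
  assumes p: "p \<in> points" and "finite \<C>" "\<C> \<subseteq> algebra_sets" "\<Union>\<C> \<in> p"
  shows "\<exists>C\<in>\<C>. C \<in> p"
proof (rule ccontr)
  assume none: "\<not> (\<exists>C\<in>\<C>. C \<in> p)"
  have "X - \<Union>\<C> \<in> p"
    using assms(2,3) none
  proof (induction \<C> rule: finite_induct)
    case empty
    then show ?case using pointsD(2)[OF p] by simp
  next
    case (insert C \<C>)
    then have "X - C \<in> p" "X - \<Union>\<C> \<in> p"
      using pointsD(4)[OF p] by auto
    then have "(X - C) \<inter> (X - \<Union>\<C>) \<in> p"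
      using pointsD(3)[OF p] by blast
    moreover have "(X - C) \<inter> (X - \<Union>\<C>) = X - \<Union>(insert C \<C>)"
      by blast
    ultimately show ?case by simp
  qed
  then have "\<Union>\<C> \<inter> (X - \<Union>\<C>) \<in> p"
    using assms(4) pointsD(3)[OF p] by blast
  then show False
    using points_nonempty[OF p] by simp
qed

text \<open>Finiteness of the index enters here: a point contains exactly one class of \<open>R\<close>, and that
  class decides membership of all \<open>R\<close>-saturated sets.\<close>

lemma same_on_class:
  assumes R: "cofin R" and p: "p \<in> points"
  obtains C where "C \<in> p" "\<And>q. q \<in> points \<Longrightarrow> C \<in> q \<Longrightarrow> (p, q) \<in> same_on R"
proof -
  note eq = cofinite_entourageD[OF R]
  have "\<Union>(X // R) \<in> p"
    using Union_quotient[OF eq(2)] pointsD(2)[OF p] by simp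
  moreover have "X // R \<subseteq> algebra_sets"
    using class_saturated[OF R] algebra_setsI[OF R] by blast
  ultimately obtain C where C: "C \<in> X // R" "C \<in> p"
    using points_finite_Union[OF p eq(3)] by blast
  \<comment> \<open>Stated for an arbitrary point containing \<open>C\<close>, so that comparing
    \<open>p\<close> with \<open>q\<close> uses it once for each. A class meeting a saturated set
    lies inside it.\<close>
  have dec: "A \<in> q \<longleftrightarrow> C \<subseteq> A" if q: "q \<in> points" "C \<in> q" and A: "A \<in> saturated R" for q A
  proof
    assume "A \<in> q"
    then have "C \<inter> A \<noteq> {}"
      using pointsD(3)[OF q(1)] points_nonempty[OF q(1)] q(2) by metis
    then obtain x where x: "x \<in> C" "x \<in> A"
      by blast
    then have "C = R `` {x}"
      using C(1) eq(2) by (metis Image_singleton_iff equiv_class_eq quotientE)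
    then show "C \<subseteq> A"
      using A x unfolding saturated_def by blast
  next
    assume "C \<subseteq> A"
    then show "A \<in> q"
      using points_upward[OF q] algebra_setsI[OF R A] by blast
  qed
  have "(p, q) \<in> same_on R" if "q \<in> points" "C \<in> q" for q
    using dec[OF that] dec[OF p C(2)] that p unfolding same_on_def by blast
  then show thesis
    using that C(2) by blast
qed

section \<open>Uniformity and topology on the points\<close>

lemma same_on_mono: "R \<subseteq> R' \<Longrightarrow> same_on R \<subseteq> same_on R'"
  using saturated_mono unfolding same_on_def by blast

lemma same_on_refl: "p \<in> points \<Longrightarrow> (p, p) \<in> same_on R"
  unfolding same_on_def by blast

lemma same_on_sym: "(p, q) \<in> same_on R \<Longrightarrow> (q, p) \<in> same_on R"
  unfolding same_on_def by blast

lemma same_on_trans: "(p, q) \<in> same_on R \<Longrightarrow> (q, r) \<in> same_on R \<Longrightarrow> (p, r) \<in> same_on R"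
  unfolding same_on_def by blast

lemma same_on_in_point_uniformity: "cofin R \<Longrightarrow> same_on R \<in> point_uniformity"
  unfolding point_uniformity_def same_on_def by blast

lemma is_uniformity_points: "is_uniformity points point_uniformity"
  unfolding is_uniformity_def
proof (intro conjI ballI allI impI)
  show "points \<times> points \<in> point_uniformity"
    using cofin_exists unfolding point_uniformity_def same_on_def by blast
next
  fix E assume "E \<in> point_uniformity"
  then obtain R where R: "cofin R" "same_on R \<subseteq> E" "E \<subseteq> points \<times> points"
    unfolding point_uniformity_def by blast
  show "Id_on points \<subseteq> E" "E \<subseteq> points \<times> points"
    using R same_on_refl by blast+
  show "F \<in> point_uniformity" if "E \<subseteq> F \<and> F \<subseteq> points \<times> points" for F
    using R that unfolding point_uniformity_def by blast
  have "same_on R \<subseteq> E\<inverse>"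
    using R(2) same_on_sym by (meson converseI subrelI subsetD)
  then show "E\<inverse> \<in> point_uniformity"
    using R(1,3) unfolding point_uniformity_def by blast
  \<comment> \<open>Transitivity lets \<open>same_on R\<close> serve as its own half-size
    entourage.\<close>
  have "same_on R O same_on R \<subseteq> same_on R"
    using same_on_trans by (meson relcompEpair subrelI)
  then show "\<exists>F\<in>point_uniformity. F O F \<subseteq> E"
    using R(1,2) same_on_in_point_uniformity by (meson order_trans)
next
  fix E F assume "E \<in> point_uniformity" "F \<in> point_uniformity"
  then obtain R R' where R: "cofin R" "same_on R \<subseteq> E" "cofin R'" "same_on R' \<subseteq> F" "E \<subseteq> points \<times> points"
    unfolding point_uniformity_def by blast
  obtain R'' where "cofin R''" "R'' \<subseteq> R" "R'' \<subseteq> R'"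
    using cofin_common R by blast
  then have "cofin R''" "same_on R'' \<subseteq> E \<inter> F"
    using R same_on_mono by blast+
  then show "E \<inter> F \<in> point_uniformity"
    using R(5) unfolding point_uniformity_def by blast
qed

lemma topspace_points: "topspace point_topology = points"
  unfolding point_topology_def by (rule topspace_uniform_topology[OF is_uniformity_points])

lemma openin_points:
  "openin point_topology S \<longleftrightarrow> S \<subseteq> points \<and> (\<forall>p\<in>S. \<exists>R. cofin R \<and> same_on R `` {p} \<subseteq> S)"
  unfolding point_topology_def openin_uniform_topology[OF is_uniformity_points]
  using same_on_in_point_uniformity unfolding point_uniformity_def by blast

lemma openin_basic:
  assumes "A \<in> algebra_sets"
  shows "openin point_topology {p \<in> points. A \<in> p}"
proof -
  obtain R where "cofin R" "A \<in> saturated R"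
    using assms algebra_setsE by blast
  then show ?thesis
    unfolding openin_points same_on_def by blast
qed

text \<open>With \<open>openin_basic\<close> this identifies the uniform topology with the Stone
  topology: the class supplied by \<open>same_on_class\<close> defines a basic neighbourhood inside
  the \<open>same_on R\<close>-class of \<open>p\<close>.\<close>

lemma openin_points_basic:
  assumes "openin point_topology S" "p \<in> S"
  obtains A where "A \<in> p" "{q \<in> points. A \<in> q} \<subseteq> S"
proof -
  obtain R where R: "cofin R" "same_on R `` {p} \<subseteq> S" and p: "p \<in> points"
    using assms unfolding openin_points by blast
  obtain C where C: "C \<in> p" "\<And>q. q \<in> points \<Longrightarrow> C \<in> q \<Longrightarrow> (p, q) \<in> same_on R"
    using same_on_class[OF R(1) p] by blast
  show thesis
    by (rule that[of C]) (use C R in blast)+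
qed

lemma Hausdorff_points: "Hausdorff_space point_topology"
  unfolding Hausdorff_space_def topspace_points
proof (intro allI impI)
  \<comment> \<open>Distinct ultrafilters differ on some \<open>A\<close>, and \<open>A\<close> and
    its complement define disjoint open sets. The case with \<open>p\<close> and \<open>q\<close>
    exchanged follows by symmetry.\<close>
  have *: "\<exists>U V. openin point_topology U \<and> openin point_topology V \<and> p \<in> U \<and> q \<in> V \<and> disjnt U V"
    if p: "p \<in> points" and q: "q \<in> points" and A: "A \<in> p" "A \<notin> q" for p q A
  proof (intro exI conjI)
    have alg: "A \<in> algebra_sets"
      using pointsD(1)[OF p] A by blast
    show "openin point_topology {p \<in> points. A \<in> p}" "openin point_topology {p \<in> points. X - A \<in> p}"
      using openin_basic alg algebra_sets_compl by blast+
    show "p \<in> {p \<in> points. A \<in> p}" "q \<in> {p \<in> points. X - A \<in> p}"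
      using p q A pointsD(4)[OF q alg] by blast+
    show "disjnt {p \<in> points. A \<in> p} {p \<in> points. X - A \<in> p}"
      using pointsD(4) alg unfolding disjnt_def by blast
  qed
  fix p q assume pq: "p \<in> points \<and> q \<in> points \<and> p \<noteq> q"
  then consider A where "A \<in> p" "A \<notin> q" | A where "A \<in> q" "A \<notin> p"
    by blast
  then show "\<exists>U V. openin point_topology U \<and> openin point_topology V \<and> p \<in> U \<and> q \<in> V \<and> disjnt U V"
    using *[of p q] *[of q p] pq by cases (metis disjnt_sym)+
qed

text \<open>The points are encoded by their characteristic functions, which form a closed subset of
  the Cantor cube.\<close>

lemma compact_points: "compact_space point_topology"
proof -
  let ?P = "product_topology (\<lambda>_ :: 'a set. discrete_topology (UNIV :: bool set)) UNIV"
  let ?K = "{\<phi>. Collect \<phi> \<in> points}"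
  have "compact_space ?P"
    by (simp add: compact_space_product_topology compact_space_discrete_topology)
  have pre: "{\<phi> \<in> topspace ?P. \<phi> A \<in> B} = {\<phi>. \<phi> A \<in> B}" for A B
    by simp
  have op: "openin ?P {\<phi>. \<phi> A \<in> B}" for A B
    using openin_continuous_map_preimage[OF continuous_map_product_projection[of A UNIV
          "\<lambda>_. discrete_topology (UNIV :: bool set)"], of B] by (simp add: pre)
  have o1: "openin ?P {\<phi>. \<phi> A}" and o2: "openin ?P {\<phi>. \<not> \<phi> A}" for A
    using op[of A "{True}"] op[of A "{False}"] by simp_all
  have neg: "topspace ?P - {\<phi>. Q \<phi>} = {\<phi>. \<not> Q \<phi>}" for Q
    by auto
  have c1: "closedin ?P {\<phi>. \<phi> A}" and c2: "closedin ?P {\<phi>. \<not> \<phi> A}" for A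
    unfolding closedin_def neg using o1 o2 by simp_all
  \<comment> \<open>Each clause in the definition of a point involves finitely many coordinates, and
    a condition on one coordinate is both open and closed, so every clause cuts out a closed
    set.\<close>
  define K1 where "K1 A = {\<phi> :: 'a set \<Rightarrow> bool. \<phi> A \<longrightarrow> A \<in> algebra_sets}" for A
  define K2 where "K2 A B = {\<phi> :: 'a set \<Rightarrow> bool. \<phi> A \<longrightarrow> \<phi> B \<longrightarrow> \<phi> (A \<inter> B)}" for A B
  define K3 where "K3 A = {\<phi> :: 'a set \<Rightarrow> bool. A \<in> algebra_sets \<longrightarrow> (\<phi> (X - A) \<longleftrightarrow> \<not> \<phi> A)}" for A
  have "K1 A = (if A \<in> algebra_sets then topspace ?P else {\<phi>. \<not> \<phi> A})" for A
    unfolding K1_def by auto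
  then have k1: "closedin ?P (K1 A)" for A
    using c2 closedin_topspace by metis
  have "K2 A B = {\<phi>. \<not> \<phi> A} \<union> {\<phi>. \<not> \<phi> B} \<union> {\<phi>. \<phi> (A \<inter> B)}" for A B
    unfolding K2_def by auto
  then have k2: "closedin ?P (K2 A B)" for A B
    using closedin_Un[OF closedin_Un[OF c2 c2] c1] by metis
  have "K3 A = (if A \<in> algebra_sets then ({\<phi>. \<phi> (X - A)} \<inter> {\<phi>. \<not> \<phi> A}) \<union>
      ({\<phi>. \<not> \<phi> (X - A)} \<inter> {\<phi>. \<phi> A}) else topspace ?P)" for A
    unfolding K3_def by auto
  moreover have "closedin ?P (({\<phi>. \<phi> (X - A)} \<inter> {\<phi>. \<not> \<phi> A}) \<union>
      ({\<phi>. \<not> \<phi> (X - A)} \<inter> {\<phi>. \<phi> A}))" for A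
    by (intro closedin_Un closedin_Int c1 c2)
  ultimately have k3: "closedin ?P (K3 A)" for A
    using closedin_topspace by metis
  have "?K = (\<Inter>A. K1 A) \<inter> {\<phi>. \<phi> X} \<inter> (\<Inter>A. \<Inter>B. K2 A B) \<inter> (\<Inter>A. K3 A)"
    unfolding points_def K1_def K2_def K3_def by auto
  moreover have "closedin ?P ((\<Inter>A. K1 A) \<inter> {\<phi>. \<phi> X} \<inter> (\<Inter>A. \<Inter>B. K2 A B) \<inter> (\<Inter>A. K3 A))"
    by (intro closedin_Int closedin_Inter c1) (auto intro!: k1 k2 k3)
  ultimately have "closedin ?P ?K"
    by simp
  then have "compactin ?P ?K"
    using \<open>compact_space ?P\<close> closedin_compact_space by blast
  then have comp: "compactin (subtopology ?P ?K) ?K"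
    by (simp add: compactin_subtopology)
  \<comment> \<open>A basic open set of points pulls back to a condition on a single
    coordinate.\<close>
  have "continuous_map (subtopology ?P ?K) point_topology Collect"
    unfolding continuous_map_def topspace_points
  proof (intro conjI allI impI)
    fix S assume S: "openin point_topology S"
    let ?pre = "{\<phi> \<in> topspace (subtopology ?P ?K). Collect \<phi> \<in> S}"
    show "openin (subtopology ?P ?K) ?pre"
    proof (subst openin_subopen, intro ballI)
      fix \<phi> assume \<phi>: "\<phi> \<in> ?pre"
      then obtain A where A: "A \<in> Collect \<phi>" "{q \<in> points. A \<in> q} \<subseteq> S"
        using openin_points_basic[OF S] by blast
      have "openin (subtopology ?P ?K) (?K \<inter> {\<phi>. \<phi> A})"
        using o1 openin_subtopology_Int2 by blast
      moreover have "\<phi> \<in> ?K \<inter> {\<phi>. \<phi> A}" "?K \<inter> {\<phi>. \<phi> A} \<subseteq> ?pre"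
        using \<phi> A by auto
      ultimately show "\<exists>U. openin (subtopology ?P ?K) U \<and> \<phi> \<in> U \<and> U \<subseteq> ?pre"
        by blast
    qed
  qed auto
  then have "compactin point_topology (Collect ` ?K)"
    using comp image_compactin by blast
  moreover have "Collect ` ?K = points"
  proof
    show "points \<subseteq> Collect ` ?K"
    proof
      fix p assume "p \<in> points"
      then show "p \<in> Collect ` ?K"
        by (intro image_eqI[of _ _ "\<lambda>A. A \<in> p"]) auto
    qed
  qed auto
  ultimately show ?thesis
    unfolding compact_space_def topspace_points by simp
qed

text \<open>\<open>point_uniformity\<close> induces the compact topology by construction, so
  uniqueness identifies it.\<close>

lemma compact_uniformity_points: "compact_uniformity point_topology = point_uniformity"
proof -
  have "point_uniformity = diagonal_nhds point_topology"
    by (rule compact_uniformity_unique)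
      (simp_all add: compact_points topspace_points is_uniformity_points point_topology_def[symmetric])
  then show ?thesis
    by (simp add: compact_uniformity_eq_diagonal_nhds compact_points Hausdorff_points)
qed

section \<open>The embedding of the graph by principal ultrafilters\<close>

lemma point_of_points: "x \<in> X \<Longrightarrow> point_of x \<in> points"
  unfolding points_def point_of_def
  using algebra_sets_top algebra_sets_Int algebra_sets_compl by blast

lemma in_class_saturated:
  assumes "cofin R" "x \<in> X"
  shows "R `` {x} \<in> saturated R" "x \<in> R `` {x}"
  using class_saturated[OF assms(1) quotientI[OF assms(2)]]
    equiv_class_self[OF cofinite_entourageD(2)[OF assms(1)] assms(2)] by auto

text \<open>The class of \<open>x\<close> is itself saturated, so agreement on saturated sets forces
  \<open>y\<close> into it; conversely related elements lie in the same saturated sets.\<close>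

lemma point_of_same_on:
  assumes R: "cofin R" and x: "x \<in> X" and "y \<in> X"
  shows "(point_of x, point_of y) \<in> same_on R \<longleftrightarrow> (x, y) \<in> R"
proof
  assume "(point_of x, point_of y) \<in> same_on R"
  moreover have "R `` {x} \<in> point_of x"
    using in_class_saturated[OF R x] algebra_setsI[OF R] unfolding point_of_def by blast
  ultimately have "R `` {x} \<in> point_of y"
    using in_class_saturated[OF R x] unfolding same_on_def by blast
  then show "(x, y) \<in> R"
    unfolding point_of_def by blast
next
  assume xy: "(x, y) \<in> R"
  then have "(y, x) \<in> R"
    using cofinite_entourageD(2)[OF R] unfolding equiv_def by (auto dest: symD)
  then have "x \<in> A \<longleftrightarrow> y \<in> A" if "A \<in> saturated R" for A
    using that xy unfolding saturated_def by blast
  then show "(point_of x, point_of y) \<in> same_on R"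
    using assms point_of_points algebra_setsI[OF R] unfolding same_on_def point_of_def by blast
qed

lemma inj_point_of: "inj_on point_of X"
proof (rule inj_onI, rule ccontr)
  fix x y assume xy: "x \<in> X" "y \<in> X" "point_of x = point_of y" "x \<noteq> y"
  have "Hausdorff_space (uniform_topology X \<U>)"
    using cofinite unfolding cofinite_dgraph_def is_hausdorff_uniformity_def by blast
  then obtain S where "openin (uniform_topology X \<U>) S" "x \<in> S" "y \<notin> S"
    using xy unfolding Hausdorff_space_def topspace_uniform_topology[OF uniformity] disjnt_iff by metis
  then obtain E where E: "E \<in> \<U>" "(x, y) \<notin> E"
    unfolding openin_uniform_topology[OF uniformity] by blast
  obtain R where R: "cofin R" "R \<subseteq> E"
    using cofin_below[OF E(1)] by blast
  have "(point_of x, point_of y) \<in> same_on R"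
    using xy point_of_points same_on_refl by metis
  then show False
    using point_of_same_on R E xy by blast
qed

text \<open>A nonempty open set contains a basic one given by a nonempty \<open>A\<close>, and with
  it the principal ultrafilter of any element of \<open>A\<close>.\<close>

lemma dense_point_of: "point_topology closure_of (point_of ` X) = points"
  unfolding topspace_points[symmetric] dense_intersects_open
proof (intro allI impI)
  fix S assume S: "openin point_topology S \<and> S \<noteq> {}"
  then obtain p where p: "p \<in> S" "p \<in> points"
    using openin_points by blast
  obtain A where A: "A \<in> p" "{q \<in> points. A \<in> q} \<subseteq> S"
    using S openin_points_basic p by metis
  have alg: "A \<in> algebra_sets" and "A \<noteq> {}"
    using A p pointsD(1) points_nonempty by blast+
  then obtain x where "x \<in> A" "x \<in> X"
    using algebra_sets_subset by blast
  then have "point_of x \<in> {q \<in> points. A \<in> q}"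
    using point_of_points alg by (simp add: point_of_def)
  then show "point_of ` X \<inter> S \<noteq> {}"
    using A(2) \<open>x \<in> X\<close> by blast
qed

lemma induced_point_of: "induced_uniformity point_of X point_uniformity = \<U>"
proof
  show "induced_uniformity point_of X point_uniformity \<subseteq> \<U>"
  proof
    fix E assume "E \<in> induced_uniformity point_of X point_uniformity"
    then obtain F R where E: "E = {(x, y). x \<in> X \<and> y \<in> X \<and> (point_of x, point_of y) \<in> F}"
      and R: "cofin R" "same_on R \<subseteq> F"
      unfolding induced_uniformity_def point_uniformity_def by blast
    have "R \<subseteq> X \<times> X"
      using is_uniformityD(3)[OF uniformity cofinite_entourageD(1)[OF R(1)]] .
    then have "R \<subseteq> E"
      using point_of_same_on[OF R(1)] R(2) unfolding E by blast
    moreover have "E \<subseteq> X \<times> X"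
      unfolding E by blast
    ultimately show "E \<in> \<U>"
      using is_uniformityD(4)[OF uniformity cofinite_entourageD(1)[OF R(1)]] by blast
  qed
  show "\<U> \<subseteq> induced_uniformity point_of X point_uniformity"
  proof
    fix E assume E: "E \<in> \<U>"
    have EX: "E \<subseteq> X \<times> X"
      by (rule is_uniformityD(3)[OF uniformity E])
    obtain R where R: "cofin R" "R \<subseteq> E"
      using cofin_below[OF E] by blast
    \<comment> \<open>The trace has to be exactly \<open>E\<close>, whereas \<open>same_on R\<close>
      alone has the possibly smaller trace \<open>R\<close>. Adding the image of \<open>E\<close>
      repairs this, and injectivity of \<open>point_of\<close> prevents further pairs from
      entering.\<close>
    let ?F = "same_on R \<union> (\<lambda>(x, y). (point_of x, point_of y)) ` E"
    have "(\<lambda>(x, y). (point_of x, point_of y)) ` E \<subseteq> points \<times> points"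
      using EX point_of_points by auto
    moreover have "same_on R \<subseteq> points \<times> points"
      unfolding same_on_def by blast
    ultimately have "?F \<in> point_uniformity"
      using R(1) unfolding point_uniformity_def by blast
    moreover have "(point_of x, point_of y) \<in> ?F \<longleftrightarrow> (x, y) \<in> E" if "x \<in> X" "y \<in> X" for x y
    proof -
      have "(point_of x, point_of y) \<in> (\<lambda>(x, y). (point_of x, point_of y)) ` E \<longleftrightarrow> (x, y) \<in> E"
      proof
        assume "(point_of x, point_of y) \<in> (\<lambda>(x, y). (point_of x, point_of y)) ` E"
        then obtain x' y' where "(x', y') \<in> E" "point_of x = point_of x'" "point_of y = point_of y'"
          by auto
        then show "(x, y) \<in> E"
          using EX that inj_onD[OF inj_point_of] by (metis SigmaE2 subsetD)
      qed (rule image_eqI, auto)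
      then show ?thesis
        using point_of_same_on[OF R(1) that] R(2) by blast
    qed
    then have "E = {(x, y). x \<in> X \<and> y \<in> X \<and> (point_of x, point_of y) \<in> ?F}"
      using EX by blast
    ultimately show "E \<in> induced_uniformity point_of X point_uniformity"
      unfolding induced_uniformity_def by blast
  qed
qed

section \<open>Source and target on the points\<close>

definition uniform_endo :: "('a \<Rightarrow> 'a) \<Rightarrow> bool" where
  "uniform_endo f \<longleftrightarrow> f \<in> X \<rightarrow> X \<and> (\<forall>R. cofin R \<longrightarrow> (\<forall>(x, y)\<in>R. (f x, f y) \<in> R))"

text \<open>Here compatibility of cofinite entourages enters: each of them is preserved as it
  stands, which is stronger than uniform continuity.\<close>

lemma uniform_endo_src: "uniform_endo (src G)" and uniform_endo_tgt: "uniform_endo (tgt G)"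
  using dgraph unfolding uniform_endo_def directed_graph_def cofinite_entourage_def
    compatible_equiv_def by fast+

lemma saturated_preimage:
  assumes "uniform_endo f" "cofin R" "A \<in> saturated R"
  shows "{x \<in> X. f x \<in> A} \<in> saturated R"
proof -
  have "R \<subseteq> X \<times> X"
    using cofinite_entourageD(2)[OF assms(2)] by (auto simp: equiv_def)
  then show ?thesis
    using assms unfolding uniform_endo_def saturated_def by blast
qed

lemma algebra_sets_preimage:
  assumes "uniform_endo f" "A \<in> algebra_sets"
  shows "{x \<in> X. f x \<in> A} \<in> algebra_sets"
  using assms algebra_setsE algebra_setsI saturated_preimage by metis

lemma in_push: "A \<in> push f p \<longleftrightarrow> A \<in> algebra_sets \<and> {x \<in> X. f x \<in> A} \<in> p"
  unfolding push_def by simp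

text \<open>Taking preimages commutes with intersections and complements and stays inside the
  algebra.\<close>

lemma push_points:
  assumes f: "uniform_endo f" and p: "p \<in> points"
  shows "push f p \<in> points"
proof -
  have top: "{x \<in> X. f x \<in> X} = X"
    using f unfolding uniform_endo_def by blast
  have int: "{x \<in> X. f x \<in> A \<inter> B} = {x \<in> X. f x \<in> A} \<inter> {x \<in> X. f x \<in> B}" for A B
    by blast
  have compl: "{x \<in> X. f x \<in> X - A} = X - {x \<in> X. f x \<in> A}" for A
    using f unfolding uniform_endo_def by blast
  have "A \<inter> B \<in> push f p" if "A \<in> push f p" "B \<in> push f p" for A B
    using that unfolding in_push int by (simp add: algebra_sets_Int pointsD(3)[OF p])
  moreover have "X - A \<in> push f p \<longleftrightarrow> A \<notin> push f p" if "A \<in> algebra_sets" for A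
    unfolding in_push compl pointsD(4)[OF p algebra_sets_preimage[OF f that]]
    by (simp add: that algebra_sets_compl)
  moreover have "X \<in> push f p"
    unfolding in_push top by (simp add: algebra_sets_top pointsD(2)[OF p])
  moreover have "push f p \<subseteq> algebra_sets"
    unfolding push_def by blast
  ultimately show ?thesis
    unfolding points_def by blast
qed

lemma push_point_of:
  assumes "uniform_endo f" "x \<in> X"
  shows "push f (point_of x) = point_of (f x)"
  using assms algebra_sets_preimage unfolding push_def point_of_def by auto

text \<open>Transfers the identities between source and target from \<open>X\<close> to
  ultrafilters: both sides test the same preimages.\<close>

lemma push_push:
  assumes "uniform_endo f" "uniform_endo g" "\<And>x. x \<in> X \<Longrightarrow> f (g x) = g x"
  shows "push f (push g p) = push g p"
proof -
  have "{x \<in> X. g x \<in> {x \<in> X. f x \<in> A}} = {x \<in> X. g x \<in> A}" for A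
    using assms unfolding uniform_endo_def by force
  then show ?thesis
    using algebra_sets_preimage[OF assms(1)] unfolding push_def by auto
qed

text \<open>Preimages of \<open>R\<close>-saturated sets are \<open>R\<close>-saturated for the same
  \<open>R\<close>, so \<open>push f\<close> preserves every \<open>same_on R\<close>.\<close>

lemma continuous_push:
  assumes f: "uniform_endo f"
  shows "continuous_map point_topology point_topology (push f)"
  unfolding continuous_map_def topspace_points
proof (intro conjI allI impI)
  show "push f \<in> points \<rightarrow> points"
    using push_points[OF f] by blast
  fix S assume S: "openin point_topology S"
  show "openin point_topology {p \<in> points. push f p \<in> S}"
    unfolding openin_points
  proof (intro conjI ballI)
    fix p assume p: "p \<in> {p \<in> points. push f p \<in> S}"
    then obtain R where R: "cofin R" "same_on R `` {push f p} \<subseteq> S"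
      using S unfolding openin_points by blast
    have "(push f p, push f q) \<in> same_on R" if pq: "(p, q) \<in> same_on R" for q
    proof -
      have "A \<in> push f p \<longleftrightarrow> A \<in> push f q" if "A \<in> saturated R" for A
        using pq saturated_preimage[OF f R(1) that] unfolding same_on_def push_def by blast
      then show ?thesis
        using pq push_points[OF f] unfolding same_on_def by blast
    qed
    then have "same_on R `` {p} \<subseteq> {p \<in> points. push f p \<in> S}"
      using R(2) unfolding same_on_def by blast
    then show "\<exists>R. cofin R \<and> same_on R `` {p} \<subseteq> {p \<in> points. push f p \<in> S}"
      using R(1) by blast
  qed blast
qed

lemma src_tgt_absorb:
  assumes "x \<in> X"
  shows "src G (src G x) = src G x" "src G (tgt G x) = tgt G x" "tgt G (src G x) = src G x"
  using assms dgraph unfolding directed_graph_def by blast+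

lemma topological_completed: "topological_dgraph completed point_topology"
proof -
  note s = uniform_endo_src and t = uniform_endo_tgt
  have V: "push (src G) p \<in> {p \<in> points. push (src G) p = p}"
    "push (tgt G) p \<in> {p \<in> points. push (src G) p = p}" if "p \<in> points" for p
    using that push_points s t push_push src_tgt_absorb by auto
  \<comment> \<open>The target map fixes sources, so an ultrafilter equal to its own source is its
    own target.\<close>
  have "push (tgt G) p = p" if "push (src G) p = p" for p
    using push_push[OF t s src_tgt_absorb(3), of p] that by simp
  then have "directed_graph completed"
    unfolding directed_graph_def completed_def using V by auto
  then show ?thesis
    unfolding topological_dgraph_def using V continuous_push s t
    by (auto simp: completed_def topspace_points continuous_map_in_subtopology)
qed

lemma completion_completed: "dgraph_completion G \<U> completed point_topology point_of"
proof -
  have inG: "src G x \<in> X" "tgt G x \<in> X" if "x \<in> X" for x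
    using dgraph that unfolding directed_graph_def by auto
  have "dgraph_map point_of G completed"
    unfolding dgraph_map_def completed_def
    using point_of_points push_point_of uniform_endo_src uniform_endo_tgt by auto
  moreover have "sub_dgraph (point_of ` X) completed"
    unfolding sub_dgraph_def completed_def
    using point_of_points push_point_of uniform_endo_src uniform_endo_tgt inG by auto
  moreover have "elems completed = points"
    unfolding completed_def by simp
  ultimately show ?thesis
    unfolding dgraph_completion_def
    using topological_completed compact_points Hausdorff_points inj_point_of dense_point_of
    by (simp add: compact_uniformity_points induced_point_of)
qed

end

theorem theorem5p6:
  fixes G :: "'a dgraph" and \<U> :: "('a \<times> 'a) set set"
  assumes "cofinite_dgraph G \<U>"
  shows "(\<exists>(D :: 'a set set dgraph) T i. dgraph_completion G \<U> D T i) \<and>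
    (\<forall>(D1 :: 'b dgraph) T1 i1 (D2 :: 'c dgraph) T2 i2.
       dgraph_completion G \<U> D1 T1 i1 \<and> dgraph_completion G \<U> D2 T2 i2 \<longrightarrow>
       (\<exists>h. topological_dgraph_iso h D1 T1 D2 T2 \<and> (\<forall>x\<in>elems G. h (i1 x) = i2 x)))"
proof -
  interpret cofinite G \<U>
    by standard (rule assms)
  show ?thesis
    using completion_completed dgraph_completion_unique[OF dgraph] by blast
qed

end
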